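(* Let $H$ be a commutative hemiring. Then $\operatorname{scl}_H(I)\operatorname{scl}_H(J) = \operatorname{scl}_H(IJ)$ for all ideals $I,J$ of $H$ if either (a) $H$ is subtractive, or (b) $H$ is austere, entire, and $H^2=H$.
   Context: A (commutative) hemiring $(H,+,\cdot)$ is a set with $(H,+)$ a commutative monoid with identity $0$, $(H,\cdot)$ a commutative semigroup, multiplication distributing over addition, and $0h=0$ for all $h\in H$. No multiplicative identity is assumed. An ideal of $H$ is a nonempty subset $I$ with $a+b\in I$ and $ha\in I$ for all $a,b\in I$, $h\in H$. An ideal $I$ is subtractive if $x+y\in I$ and $x\in I$ imply $y\in I$, for all $x,y\in H$. For ideals $I,J$, $IJ$ is the set of all finite sums of products $ij$ with $i\in I$, $j\in J$; $H^2=H\cdot H$ in this sense. $\operatorname{scl}_H(I)$ is the intersection of all subtractive ideals of $H$ containing $I$. $H$ is subtractive if all of its ideals are subtractive; austere if its only subtractive ideals are $\{0\}$ and $H$; entire if $ab=0$ implies $a=0$ or $b=0$ for all $a,b\in H$. *)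

(* Commutative hemirings are the types of class comm_semiring_0: (+, 0) is a commutative monoid,
   multiplication is associative and commutative, distributes over addition and is annihilated
   by 0; no multiplicative identity is required.  The hemiring H is the whole type, UNIV. *)
theory Defs
  imports Main
begin

definition hemiring_ideal :: "'a::comm_semiring_0 set \<Rightarrow> bool" where
  "hemiring_ideal I \<longleftrightarrow>
     I \<noteq> {} \<and> (\<forall>a\<in>I. \<forall>b\<in>I. a + b \<in> I) \<and> (\<forall>h. \<forall>a\<in>I. h * a \<in> I)"

definition subtractive_ideal :: "'a::comm_semiring_0 set \<Rightarrow> bool" where
  "subtractive_ideal I \<longleftrightarrow>
     hemiring_ideal I \<and> (\<forall>x y. x + y \<in> I \<longrightarrow> x \<in> I \<longrightarrow> y \<in> I)"

(* The empty sum (n = 0) is allowed; it only contributes 0, which already lies in IJ when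
   I and J are ideals. *)
definition ideal_mult :: "'a::comm_semiring_0 set \<Rightarrow> 'a set \<Rightarrow> 'a set" where
  "ideal_mult I J =
     {(\<Sum>k<n. a k * b k) | (n::nat) a b. \<forall>k<n. a k \<in> I \<and> b k \<in> J}"

definition scl :: "'a::comm_semiring_0 set \<Rightarrow> 'a set" where
  "scl I = \<Inter> {K. subtractive_ideal K \<and> I \<subseteq> K}"

definition subtractive_hemiring :: "'a::comm_semiring_0 itself \<Rightarrow> bool" where
  "subtractive_hemiring _ \<longleftrightarrow> (\<forall>I :: 'a set. hemiring_ideal I \<longrightarrow> subtractive_ideal I)"

(* {0} and UNIV are always subtractive ideals, so only this inclusion carries content. The zero
   hemiring counts as austere. *)
definition austere_hemiring :: "'a::comm_semiring_0 itself \<Rightarrow> bool" where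
  "austere_hemiring _ \<longleftrightarrow> (\<forall>I :: 'a set. subtractive_ideal I \<longrightarrow> I = {0} \<or> I = UNIV)"

definition entire_hemiring :: "'a::comm_semiring_0 itself \<Rightarrow> bool" where
  "entire_hemiring _ \<longleftrightarrow> (\<forall>a b :: 'a. a * b = 0 \<longrightarrow> a = 0 \<or> b = 0)"

end

theory Submission
  imports Defs
begin

text \<open>In a subtractive hemiring \<open>scl\<close> fixes every ideal. As \<open>IJ\<close> is
  itself an ideal (\<open>hemiring_ideal_ideal_mult\<close>), both sides are then \<open>IJ\<close>.
  In an austere hemiring the closure of an ideal can only be \<open>{0}\<close> or everything, and
  it is \<open>{0}\<close> exactly for the zero ideal (\<open>scl_austere\<close>). If
  \<open>I\<close> or \<open>J\<close> is zero, both sides are therefore \<open>{0}\<close>. If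
  neither is, entireness keeps the product nonzero (\<open>ideal_mult_nonzero\<close>), so the right
  side is \<open>UNIV\<close>, while the left side is the square of \<open>UNIV\<close>, which is
  \<open>UNIV\<close> by assumption.\<close>

lemma zero_in_ideal:
  assumes "hemiring_ideal I"
  shows "0 \<in> I"
proof -
  obtain a where "a \<in> I" using assms by (auto simp: hemiring_ideal_def)
  \<comment> \<open>Ideals are only required to be nonempty; absorbing the multiplier 0 recovers the
    zero element.\<close>
  then have "0 * a \<in> I" using assms unfolding hemiring_ideal_def by blast
  then show ?thesis by simp
qed

lemma zero_in_ideal_mult: "0 \<in> ideal_mult I J"
  unfolding ideal_mult_def by (auto intro!: exI[of _ "0::nat"])

text \<open>Sums run over an initial segment of the naturals, so one more product is appended by
  updating both sequences at the first free index \<open>n\<close>.\<close>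

lemma ideal_mult_add_prod:
  assumes "x \<in> ideal_mult I J" "i \<in> I" "j \<in> J"
  shows "x + i * j \<in> ideal_mult I J"
proof -
  obtain n :: nat and a b where x: "x = (\<Sum>k<n. a k * b k)" and ab: "\<forall>k<n. a k \<in> I \<and> b k \<in> J"
    using assms(1) unfolding ideal_mult_def by blast
  let ?a = "a(n := i)" and ?b = "b(n := j)"
  have "x + i * j = (\<Sum>k<Suc n. ?a k * ?b k)" by (simp add: x)
  moreover have "\<forall>k<Suc n. ?a k \<in> I \<and> ?b k \<in> J" using ab assms by (simp add: less_Suc_eq)
  ultimately show ?thesis unfolding ideal_mult_def by blast
qed

lemma prod_in_ideal_mult:
  assumes "i \<in> I" "j \<in> J"
  shows "i * j \<in> ideal_mult I J"
  using ideal_mult_add_prod[OF zero_in_ideal_mult assms] by simp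

lemma ideal_mult_add:
  assumes "x \<in> ideal_mult I J" "y \<in> ideal_mult I J"
  shows "x + y \<in> ideal_mult I J"
proof -
  obtain n :: nat and a b where y: "y = (\<Sum>k<n. a k * b k)" and ab: "\<forall>k<n. a k \<in> I \<and> b k \<in> J"
    using assms(2) unfolding ideal_mult_def by blast
  \<comment> \<open>The products of \<open>y\<close> are added to \<open>x\<close> one at a time,
    which avoids concatenating two sequences. The bound \<open>m \<le> n\<close> is there because
    the factors are known to lie in \<open>I\<close> and \<open>J\<close> only below
    \<open>n\<close>.\<close>
  have "m \<le> n \<Longrightarrow> x + (\<Sum>k<m. a k * b k) \<in> ideal_mult I J" for m
  proof (induction m)
    case 0
    then show ?case using assms(1) by simp
  next
    case (Suc m)
    then show ?case using ab ideal_mult_add_prod[of _ I J "a m" "b m"]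
      by (simp flip: add.assoc)
  qed
  then show ?thesis using y by simp
qed

text \<open>A multiplier is distributed over the sum and absorbed into the left factors, which stay
  in \<open>I\<close>.\<close>

lemma hemiring_ideal_ideal_mult:
  assumes "hemiring_ideal I"
  shows "hemiring_ideal (ideal_mult I J)"
proof -
  have "h * x \<in> ideal_mult I J" if x_in: "x \<in> ideal_mult I J" for h x
  proof -
    obtain n :: nat and a b where x: "x = (\<Sum>k<n. a k * b k)" and ab: "\<forall>k<n. a k \<in> I \<and> b k \<in> J"
      using x_in unfolding ideal_mult_def by blast
    have "h * x = (\<Sum>k<n. (h * a k) * b k)" by (simp add: x sum_distrib_left mult.assoc)
    moreover have "\<forall>k<n. h * a k \<in> I \<and> b k \<in> J"
      using ab assms unfolding hemiring_ideal_def by blast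
    ultimately show ?thesis
      unfolding ideal_mult_def by (intro CollectI exI[of _ n] exI[of _ "\<lambda>k. h * a k"] exI[of _ b]) simp
  qed
  then show ?thesis
    unfolding hemiring_ideal_def using zero_in_ideal_mult[of I J] ideal_mult_add by blast
qed

lemma ideal_mult_zero_left: "ideal_mult {0} J = {0}"
proof -
  have "ideal_mult {0} J \<subseteq> {0}" unfolding ideal_mult_def by auto
  then show ?thesis using zero_in_ideal_mult[of "{0}" J] by blast
qed

lemma ideal_mult_zero_right: "ideal_mult I {0} = {0}"
proof -
  have "ideal_mult I {0} \<subseteq> {0}" unfolding ideal_mult_def by auto
  then show ?thesis using zero_in_ideal_mult[of I "{0}"] by blast
qed

text \<open>Nonzero elements of \<open>I\<close> and \<open>J\<close> have a nonzero product, and it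
  lies in \<open>IJ\<close>.\<close>

lemma ideal_mult_nonzero:
  assumes "entire_hemiring TYPE('a::comm_semiring_0)"
    and "hemiring_ideal (I :: 'a set)" "I \<noteq> {0}" "hemiring_ideal J" "J \<noteq> {0}"
  shows "ideal_mult I J \<noteq> {0}"
proof -
  obtain i where i: "i \<in> I" "i \<noteq> 0" using assms(2,3) zero_in_ideal by blast
  obtain j where j: "j \<in> J" "j \<noteq> 0" using assms(4,5) zero_in_ideal by blast
  have "i * j \<noteq> 0" using assms(1) i j unfolding entire_hemiring_def by blast
  then show ?thesis using prod_in_ideal_mult[OF i(1) j(1)] by auto
qed

lemma subset_scl: "I \<subseteq> scl I"
  unfolding scl_def by blast

lemma scl_subtractive_ideal: "subtractive_ideal I \<Longrightarrow> scl I = I"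
  unfolding scl_def by blast

lemma subtractive_ideal_zero: "subtractive_ideal {0::'a::comm_semiring_0}"
  by (simp add: subtractive_ideal_def hemiring_ideal_def)

lemma subtractive_idealD:
  assumes "subtractive_ideal K"
  shows "0 \<in> K"
    and "a \<in> K \<Longrightarrow> b \<in> K \<Longrightarrow> a + b \<in> K"
    and "a \<in> K \<Longrightarrow> h * a \<in> K"
    and "x + y \<in> K \<Longrightarrow> x \<in> K \<Longrightarrow> y \<in> K"
  using assms zero_in_ideal[of K] unfolding subtractive_ideal_def hemiring_ideal_def by blast+

lemma mem_scl_iff: "x \<in> scl I \<longleftrightarrow> (\<forall>K. subtractive_ideal K \<longrightarrow> I \<subseteq> K \<longrightarrow> x \<in> K)"
  unfolding scl_def by blast

text \<open>Each closure condition passes to intersections. This is what lets austerity be applied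
  to \<open>scl I\<close>.\<close>

lemma subtractive_ideal_scl: "subtractive_ideal (scl I)"
  unfolding subtractive_ideal_def hemiring_ideal_def
proof (intro conjI allI ballI impI)
  have "0 \<in> scl I" by (simp add: mem_scl_iff subtractive_idealD(1))
  then show "scl I \<noteq> {}" by blast
next
  fix a b assume "a \<in> scl I" "b \<in> scl I"
  then show "a + b \<in> scl I" by (simp add: mem_scl_iff subtractive_idealD(2))
next
  fix h a assume "a \<in> scl I"
  then show "h * a \<in> scl I" by (simp add: mem_scl_iff subtractive_idealD(3))
next
  fix x y assume "x + y \<in> scl I" "x \<in> scl I"
  then show "y \<in> scl I" unfolding mem_scl_iff using subtractive_idealD(4) by blast
qed

text \<open>Austerity leaves two candidates for \<open>scl I\<close>, and
  \<open>I \<subseteq> scl I\<close> excludes \<open>{0}\<close> as soon as \<open>I\<close> has a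
  nonzero element.\<close>

lemma scl_austere:
  assumes "austere_hemiring TYPE('a::comm_semiring_0)" "hemiring_ideal (I :: 'a set)"
  shows "scl I = (if I = {0} then {0} else UNIV)"
proof (cases "I = {0}")
  case True
  then show ?thesis by (simp add: scl_subtractive_ideal subtractive_ideal_zero)
next
  case False
  then have "scl I \<noteq> {0}" using subset_scl[of I] zero_in_ideal[OF assms(2)] by blast
  then show ?thesis
    using False assms(1) subtractive_ideal_scl[of I] unfolding austere_hemiring_def by auto
qed

theorem proposition5p7:
  assumes "subtractive_hemiring TYPE('a::comm_semiring_0) \<or>
    (austere_hemiring TYPE('a) \<and> entire_hemiring TYPE('a) \<and>
      ideal_mult (UNIV :: 'a set) UNIV = UNIV)"
  shows "\<forall>I J :: 'a set. hemiring_ideal I \<longrightarrow> hemiring_ideal J \<longrightarrow>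
    ideal_mult (scl I) (scl J) = scl (ideal_mult I J)"
proof (intro allI impI)
  fix I J :: "'a set"
  assume I: "hemiring_ideal I" and J: "hemiring_ideal J"
  note IJ = hemiring_ideal_ideal_mult[OF I, of J]
  from assms show "ideal_mult (scl I) (scl J) = scl (ideal_mult I J)"
  proof (elim disjE conjE)
    assume "subtractive_hemiring TYPE('a)"
    then have "scl K = K" if "hemiring_ideal K" for K :: "'a set"
      using that scl_subtractive_ideal unfolding subtractive_hemiring_def by blast
    then show ?thesis using I J IJ by simp
  next
    assume "austere_hemiring TYPE('a)" and "entire_hemiring TYPE('a)"
      and "ideal_mult (UNIV :: 'a set) UNIV = UNIV"
    \<comment> \<open>Rewriting with \<open>scl_austere\<close> splits on whether \<open>I\<close>,
      \<open>J\<close> and \<open>IJ\<close> are zero; \<open>ideal_mult_nonzero\<close> rules out a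
      zero product of nonzero ideals.\<close>
    then show ?thesis
      using I J IJ ideal_mult_nonzero[of I J]
      by (auto simp: scl_austere ideal_mult_zero_left ideal_mult_zero_right)
  qed
qed

end
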